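(* Let $F_1,\ldots,F_n$ be finite dimensional Banach spaces and, for each $j\in\{1,\ldots,n\}$, let $\{x_1^j,\ldots,x_{d_j}^j\}$ be an Auerbach basis of $F_j$, with biorthogonal normalized dual basis $\{{x^*}_1^j,\ldots,{x^*}_{d_j}^j\}\subset F_j^*$. Then, for any reasonable cross norm $\alpha$ on $F_1\otimes\cdots\otimes F_n$, the set $$\{x_{k_1}^1\otimes\cdots\otimes x_{k_n}^n:\ 1\le k_j\le d_j,\ j=1,\ldots,n\}$$ is an Auerbach basis of $(F_1\otimes\cdots\otimes F_n,\alpha)$, whose dual basis is $$\{{x^*}_{k_1}^1\otimes\cdots\otimes {x^*}_{k_n}^n:\ 1\le k_j\le d_j,\ j=1,\ldots,n\}.$$
   Context: Spaces are over the same field $\mathbb{R}$ or $\mathbb{C}$. A basis $\{x_1,\ldots,x_d\}$ of a finite dimensional Banach space $F$ is an Auerbach basis if there is a basis $\{x_1^*,\ldots,x_d^*\}$ of $F^*$ (the dual basis) with $x_i^*(x_j)=\delta_{ij}$ and $\|x_i\|=\|x_i^*\|=1$ for all $i,j$. A norm $\alpha$ on $F_1\otimes\cdots\otimes F_n$ is a reasonable cross norm if (1) $\alpha(x_1\otimes\cdots\otimes x_n)\le\|x_1\|\cdots\|x_n\|$ for all $x_i\in F_i$, and (2) for all $x_i^*\in F_i^*$ the functional $x_1^*\otimes\cdots\otimes x_n^*$, given by $(x_1^*\otimes\cdots\otimes x_n^* )(y_1\otimes\cdots\otimes y_n)=x_1^*(y_1)\cdots x_n^*(y_n)$, is bounded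 for $\alpha$ with norm at most $\|x_1^*\|\cdots\|x_n^*\|$. *)

theory Defs
  imports Complex_Main "HOL-Library.FuncSet" "HOL-Library.Function_Algebras"
begin

text \<open>
  The scalar field is a type of class \<open>real_normed_field\<close> and \<open>banach\<close>. Instances are
  \<open>real\<close> and \<open>complex\<close>; by the Gelfand--Mazur theorem these are the only ones up to isometric
  isomorphism. To speak about families of spaces of varying dimension, a space is a linear
  subspace \<open>F\<close> of an ambient vector space (a type with scalar multiplication \<open>s\<close>), and its norm is
  a function \<open>N\<close> whose values outside \<open>F\<close> are irrelevant. Every finite family of vector spaces
  embeds into a common one (their direct sum), so this is no restriction.
\<close>

definition norm_on ::
  "('k::real_normed_field \<Rightarrow> 'a::ab_group_add \<Rightarrow> 'a) \<Rightarrow> 'a set \<Rightarrow> ('a \<Rightarrow> real) \<Rightarrow> bool" where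
  "norm_on s F N \<longleftrightarrow>
     (\<forall>x\<in>F. 0 \<le> N x \<and> (N x = 0 \<longleftrightarrow> x = 0)) \<and>
     (\<forall>c. \<forall>x\<in>F. N (s c x) = norm c * N x) \<and>
     (\<forall>x\<in>F. \<forall>y\<in>F. N (x + y) \<le> N x + N y)"

definition complete_on :: "'a::ab_group_add set \<Rightarrow> ('a \<Rightarrow> real) \<Rightarrow> bool" where
  "complete_on F N \<longleftrightarrow>
     (\<forall>u :: nat \<Rightarrow> 'a. range u \<subseteq> F \<and> (\<forall>e>0. \<exists>M. \<forall>p\<ge>M. \<forall>q\<ge>M. N (u p - u q) < e) \<longrightarrow>
       (\<exists>l\<in>F. (\<lambda>p. N (u p - l)) \<longlonglongrightarrow> 0))"

definition finite_dim_banach ::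
  "('k::real_normed_field \<Rightarrow> 'a::ab_group_add \<Rightarrow> 'a) \<Rightarrow> 'a set \<Rightarrow> ('a \<Rightarrow> real) \<Rightarrow> bool" where
  "finite_dim_banach s F N \<longleftrightarrow>
     module.subspace s F \<and> (\<exists>B. finite B \<and> module.span s B = F) \<and> norm_on s F N \<and> complete_on F N"

definition linear_on ::
  "('k \<Rightarrow> 'a::ab_group_add \<Rightarrow> 'a) \<Rightarrow> ('k \<Rightarrow> 'b::ab_group_add \<Rightarrow> 'b) \<Rightarrow> 'a set \<Rightarrow> ('a \<Rightarrow> 'b) \<Rightarrow> bool" where
  "linear_on s s' F f \<longleftrightarrow>
     (\<forall>x\<in>F. \<forall>y\<in>F. f (x + y) = f x + f y) \<and> (\<forall>c. \<forall>x\<in>F. f (s c x) = s' c (f x))"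

definition fun_scale :: "'k::times \<Rightarrow> ('b \<Rightarrow> 'k) \<Rightarrow> 'b \<Rightarrow> 'k" where
  "fun_scale c f = (\<lambda>x. c * f x)"

lemma vector_space_fun_scale: "vector_space (fun_scale :: 'k::field \<Rightarrow> ('b \<Rightarrow> 'k) \<Rightarrow> 'b \<Rightarrow> 'k)"
  by unfold_locales (auto simp: fun_scale_def fun_eq_iff algebra_simps)

text \<open>
  A functional on \<open>F\<close> is represented by the function that extends it by \<open>0\<close> outside \<open>F\<close>. Thus
  equal functionals are equal functions, and the dual space is a subspace of the function space
  with scalar multiplication \<^const>\<open>fun_scale\<close>.
\<close>

definition dual_space ::
  "('k::real_normed_field \<Rightarrow> 'a::ab_group_add \<Rightarrow> 'a) \<Rightarrow> 'a set \<Rightarrow> ('a \<Rightarrow> real) \<Rightarrow> ('a \<Rightarrow> 'k) set" where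
  "dual_space s F N =
     {f. linear_on s (*) F f \<and> (\<forall>x. x \<notin> F \<longrightarrow> f x = 0) \<and> (\<exists>C. \<forall>x\<in>F. norm (f x) \<le> C * N x)}"

definition dual_norm :: "'a set \<Rightarrow> ('a \<Rightarrow> real) \<Rightarrow> ('a \<Rightarrow> 'k::real_normed_field) \<Rightarrow> real" where
  "dual_norm F N f = (SUP x\<in>{x\<in>F. N x \<le> 1}. norm (f x))"

text \<open>Bases are indexed families, so that a basis can be matched with its dual basis.\<close>

definition family_basis ::
  "('k::field \<Rightarrow> 'a::ab_group_add \<Rightarrow> 'a) \<Rightarrow> 'a set \<Rightarrow> 'i set \<Rightarrow> ('i \<Rightarrow> 'a) \<Rightarrow> bool" where
  "family_basis s F I x \<longleftrightarrow>
     inj_on x I \<and> \<not> module.dependent s (x ` I) \<and> module.span s (x ` I) = F"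

definition normalized_dual_basis ::
  "('k::real_normed_field \<Rightarrow> 'a::ab_group_add \<Rightarrow> 'a) \<Rightarrow> 'a set \<Rightarrow> ('a \<Rightarrow> real) \<Rightarrow>
     'i set \<Rightarrow> ('i \<Rightarrow> 'a) \<Rightarrow> ('i \<Rightarrow> 'a \<Rightarrow> 'k) \<Rightarrow> bool" where
  "normalized_dual_basis s F N I x xs \<longleftrightarrow>
     family_basis fun_scale (dual_space s F N) I xs \<and>
     (\<forall>i\<in>I. \<forall>j\<in>I. xs i (x j) = (if i = j then 1 else 0)) \<and>
     (\<forall>i\<in>I. dual_norm F N (xs i) = 1)"

definition auerbach_basis ::
  "('k::real_normed_field \<Rightarrow> 'a::ab_group_add \<Rightarrow> 'a) \<Rightarrow> 'a set \<Rightarrow> ('a \<Rightarrow> real) \<Rightarrow>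
     'i set \<Rightarrow> ('i \<Rightarrow> 'a) \<Rightarrow> bool" where
  "auerbach_basis s F N I x \<longleftrightarrow>
     family_basis s F I x \<and> (\<forall>i\<in>I. N (x i) = 1) \<and> (\<exists>xs. normalized_dual_basis s F N I x xs)"

definition multilinear_on ::
  "('k \<Rightarrow> 'a::ab_group_add \<Rightarrow> 'a) \<Rightarrow> ('k \<Rightarrow> 'b::ab_group_add \<Rightarrow> 'b) \<Rightarrow>
     'i set \<Rightarrow> ('i \<Rightarrow> 'a set) \<Rightarrow> (('i \<Rightarrow> 'a) \<Rightarrow> 'b) \<Rightarrow> bool" where
  "multilinear_on s s' I F g \<longleftrightarrow>
     (\<forall>x\<in>Pi\<^sub>E I F. \<forall>i\<in>I. linear_on s s' (F i) (\<lambda>y. g (x(i := y))))"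

text \<open>
  The algebraic tensor product is constructed as the space spanned by the evaluations
  \<open>x \<mapsto> (g \<mapsto> g x)\<close> inside the space of functionals on the multilinear forms on \<open>\<Prod>\<^sub>i F i\<close>. The
  lemmas below show that it has the universal property of the tensor product.
\<close>

type_synonym ('i, 'a, 'k) tensor = "(('i \<Rightarrow> 'a) \<Rightarrow> 'k) \<Rightarrow> 'k"

definition tensor ::
  "('k::field \<Rightarrow> 'a::ab_group_add \<Rightarrow> 'a) \<Rightarrow> 'i set \<Rightarrow> ('i \<Rightarrow> 'a set) \<Rightarrow> ('i \<Rightarrow> 'a) \<Rightarrow> ('i, 'a, 'k) tensor" where
  "tensor s I F x = (\<lambda>g. if multilinear_on s (*) I F g then g (restrict x I) else 0)"

definition tensor_space ::
  "('k::field \<Rightarrow> 'a::ab_group_add \<Rightarrow> 'a) \<Rightarrow> 'i set \<Rightarrow> ('i \<Rightarrow> 'a set) \<Rightarrow> ('i, 'a, 'k) tensor set" where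
  "tensor_space s I F = module.span fun_scale (tensor s I F ` Pi\<^sub>E I F)"

text \<open>
  The functional \<open>\<Otimes>\<^sub>i f i\<close> on the tensor product is evaluation at the multilinear form
  \<open>y \<mapsto> \<Prod>\<^sub>i f i (y i)\<close>; see \<open>tensor_functional_unique\<close> for its characterization by the values
  on elementary tensors.
\<close>

definition tensor_functional ::
  "('k::field \<Rightarrow> 'a::ab_group_add \<Rightarrow> 'a) \<Rightarrow> 'i set \<Rightarrow> ('i \<Rightarrow> 'a set) \<Rightarrow> ('i \<Rightarrow> 'a \<Rightarrow> 'k) \<Rightarrow>
     ('i, 'a, 'k) tensor \<Rightarrow> 'k" where
  "tensor_functional s I F f =
     (\<lambda>u. if u \<in> tensor_space s I F then u (\<lambda>y. \<Prod>i\<in>I. f i (y i)) else 0)"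

definition reasonable_cross_norm ::
  "('k::real_normed_field \<Rightarrow> 'a::ab_group_add \<Rightarrow> 'a) \<Rightarrow> 'i set \<Rightarrow> ('i \<Rightarrow> 'a set) \<Rightarrow> ('i \<Rightarrow> 'a \<Rightarrow> real) \<Rightarrow>
     (('i, 'a, 'k) tensor \<Rightarrow> real) \<Rightarrow> bool" where
  "reasonable_cross_norm s I F N \<alpha> \<longleftrightarrow>
     norm_on fun_scale (tensor_space s I F) \<alpha> \<and>
     (\<forall>x\<in>Pi\<^sub>E I F. \<alpha> (tensor s I F x) \<le> (\<Prod>i\<in>I. N i (x i))) \<and>
     (\<forall>f. (\<forall>i\<in>I. f i \<in> dual_space s (F i) (N i)) \<longrightarrow>
        tensor_functional s I F f \<in> dual_space fun_scale (tensor_space s I F) \<alpha> \<and>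
        dual_norm (tensor_space s I F) \<alpha> (tensor_functional s I F f)
          \<le> (\<Prod>i\<in>I. dual_norm (F i) (N i) (f i)))"

lemma multilinear_on_tensor:
  shows "multilinear_on s fun_scale I F (tensor s I F)"
proof -
  have r: "restrict (x(i := y)) I = x(i := y)" if "x \<in> Pi\<^sub>E I F" "i \<in> I" for x i y
    using that by (auto simp: fun_eq_iff PiE_def extensional_def)
  show ?thesis
    unfolding multilinear_on_def linear_on_def
  proof (intro ballI conjI allI)
    fix x i y z
    assume "x \<in> Pi\<^sub>E I F" "i \<in> I" "y \<in> F i" "z \<in> F i"
    then show "tensor s I F (x(i := y + z)) = tensor s I F (x(i := y)) + tensor s I F (x(i := z))"
      by (auto simp: tensor_def r fun_eq_iff multilinear_on_def linear_on_def)
  next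
    fix x i c y
    assume "x \<in> Pi\<^sub>E I F" "i \<in> I" "y \<in> F i"
    then show "tensor s I F (x(i := s c y)) = fun_scale c (tensor s I F (x(i := y)))"
      by (auto simp: tensor_def r fun_eq_iff multilinear_on_def linear_on_def fun_scale_def)
  qed
qed

lemma tensor_in_tensor_space: "x \<in> Pi\<^sub>E I F \<Longrightarrow> tensor s I F x \<in> tensor_space s I F"
  for s :: "'k::field \<Rightarrow> 'a::ab_group_add \<Rightarrow> 'a"
proof -
  interpret T: vector_space "fun_scale :: 'k \<Rightarrow> ('i, 'a, 'k) tensor \<Rightarrow> ('i, 'a, 'k) tensor"
    by (rule vector_space_fun_scale)
  show "x \<in> Pi\<^sub>E I F \<Longrightarrow> tensor s I F x \<in> tensor_space s I F"
    by (auto simp: tensor_space_def intro: T.span_base)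
qed

lemma linear_on_tensor_space_eqI:
  fixes s :: "'k::field \<Rightarrow> 'a::ab_group_add \<Rightarrow> 'a"
  assumes "vector_space s'"
    and h: "linear_on fun_scale s' (tensor_space s I F) h"
    and h': "linear_on fun_scale s' (tensor_space s I F) h'"
    and eq: "\<And>x. x \<in> Pi\<^sub>E I F \<Longrightarrow> h (tensor s I F x) = h' (tensor s I F x)"
    and u: "u \<in> tensor_space s I F"
  shows "h u = h' u"
proof -
  interpret T: vector_space "fun_scale :: 'k \<Rightarrow> ('i, 'a, 'k) tensor \<Rightarrow> ('i, 'a, 'k) tensor"
    by (rule vector_space_fun_scale)
  interpret W: vector_space s' by fact
  have 0: "h 0 = 0 \<and> h' 0 = 0" using h h' T.span_zero
    unfolding linear_on_def tensor_space_def by (metis W.scale_zero_left T.scale_zero_left)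
  have "u \<in> T.span (tensor s I F ` Pi\<^sub>E I F)" using u by (simp add: tensor_space_def)
  then have "u \<in> tensor_space s I F \<and> h u = h' u"
  proof (induction rule: T.span_induct_alt)
    case base
    show ?case using 0 T.span_zero[of "tensor s I F ` Pi\<^sub>E I F"]
      by (simp add: tensor_space_def zero_fun_def)
  next
    case (step c y z)
    then have y: "y \<in> tensor_space s I F" and "h y = h' y"
      by (auto simp: eq tensor_in_tensor_space)
    moreover from y have "fun_scale c y \<in> tensor_space s I F"
      by (auto simp: tensor_space_def intro: T.span_scale)
    moreover from this step have "fun_scale c y + z \<in> tensor_space s I F"
      unfolding tensor_space_def by (intro T.span_add) auto
    ultimately show ?case using step h h' unfolding linear_on_def by (metis (lifting))
  qed
  then show ?thesis ..
qed

theorem tensor_space_universal: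
  fixes s :: "'k::field \<Rightarrow> 'a::ab_group_add \<Rightarrow> 'a" and g :: "('i \<Rightarrow> 'a) \<Rightarrow> 'b::ab_group_add"
  assumes "vector_space s'" and g: "multilinear_on s s' I F g"
  shows "\<exists>h. linear_on fun_scale s' (tensor_space s I F) h \<and>
    (\<forall>x\<in>Pi\<^sub>E I F. h (tensor s I F x) = g x)"
proof -
  interpret T: vector_space "fun_scale :: 'k \<Rightarrow> ('i, 'a, 'k) tensor \<Rightarrow> ('i, 'a, 'k) tensor"
    by (rule vector_space_fun_scale)
  interpret W: vector_space s' by fact
  interpret K: vector_space "(*) :: 'k \<Rightarrow> 'k \<Rightarrow> 'k"
    by unfold_locales (auto simp: algebra_simps)
  interpret TW: vector_space_pair "fun_scale :: 'k \<Rightarrow> ('i, 'a, 'k) tensor \<Rightarrow> ('i, 'a, 'k) tensor" s' ..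
  interpret WK: vector_space_pair s' "(*) :: 'k \<Rightarrow> 'k \<Rightarrow> 'k" ..
  let ?t = "tensor s I F" and ?P = "Pi\<^sub>E I F"
  obtain B where B: "B \<subseteq> ?t ` ?P" "T.independent B" "?t ` ?P \<subseteq> T.span B"
    using T.maximal_independent_subset by blast
  obtain r where r: "\<And>b. b \<in> B \<Longrightarrow> r b \<in> ?P \<and> ?t (r b) = b"
    using B(1) by (metis (no_types, lifting) image_iff subsetD)
  define h where "h = TW.construct B (\<lambda>b. g (r b))"
  have lin: "Vector_Spaces.linear fun_scale s' h"
    unfolding h_def by (rule TW.linear_construct[OF B(2)])
  have hB: "h b = g (r b)" if "b \<in> B" for b
    unfolding h_def by (rule TW.construct_basis[OF B(2) that])
  have "h (?t x) = g x" if x: "x \<in> ?P" for x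
  proof (rule ccontr)
    assume neq: "h (?t x) \<noteq> g x"
    define w where "w = g x - h (?t x)"
    have "w \<noteq> 0" using neq by (simp add: w_def)
    then have ind: "W.independent {w}" by simp
    define f where "f = WK.construct {w} (\<lambda>_. 1 :: 'k)"
    have f: "Vector_Spaces.linear s' (*) f"
      unfolding f_def by (rule WK.linear_construct[OF ind])
    have fw: "f w = 1"
      unfolding f_def using WK.construct_basis[OF ind, of w] by simp
    have fg: "multilinear_on s (*) I F (\<lambda>y. f (g y))"
      using g WK.linear_add[OF f] WK.linear_scale[OF f]
      by (simp add: multilinear_on_def linear_on_def)
    have ev: "?t y (\<lambda>y. f (g y)) = f (g y)" if "y \<in> ?P" for y
      using fg that by (simp add: tensor_def)
    have "?t x \<in> T.span B" using B(3) x by auto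
    then have "?t x (\<lambda>y. f (g y)) = f (h (?t x))"
    proof (induction rule: T.span_induct_alt)
      case base
      then show ?case using TW.linear_0[OF lin] WK.linear_0[OF f] by (simp add: zero_fun_def)
    next
      case (step c b z)
      have "b (\<lambda>y. f (g y)) = f (h b)" using ev[of "r b"] r[OF step(1)] hB[OF step(1)] by simp
      moreover have "f (h (fun_scale c b + z)) = c * f (h b) + f (h z)"
        by (simp add: TW.linear_add[OF lin] TW.linear_scale[OF lin]
            WK.linear_add[OF f] WK.linear_scale[OF f])
      ultimately show ?case using step by (simp add: fun_scale_def plus_fun_def)
    qed
    then have "f (g x) = f (h (?t x))" using ev[OF x] by simp
    then have "f w = 0" by (simp add: w_def WK.linear_diff[OF f])
    then show False using fw by simp
  qed
  moreover have "linear_on fun_scale s' (tensor_space s I F) h"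
    using TW.linear_add[OF lin] TW.linear_scale[OF lin] by (simp add: linear_on_def)
  ultimately show ?thesis by blast
qed

lemma linear_on_tensor_functional:
  fixes s :: "'k::field \<Rightarrow> 'a::ab_group_add \<Rightarrow> 'a" and f :: "'i \<Rightarrow> 'a \<Rightarrow> 'k"
  shows "linear_on fun_scale (*) (tensor_space s I F) (tensor_functional s I F f)"
proof -
  interpret T: vector_space "fun_scale :: 'k \<Rightarrow> ('i, 'a, 'k) tensor \<Rightarrow> ('i, 'a, 'k) tensor"
    by (rule vector_space_fun_scale)
  have "u + v \<in> tensor_space s I F \<and> fun_scale c u \<in> tensor_space s I F"
    if "u \<in> tensor_space s I F" "v \<in> tensor_space s I F" for u v :: "('i, 'a, 'k) tensor" and c
    using that by (auto simp: tensor_space_def intro: T.span_add T.span_scale)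
  then show ?thesis
    by (auto simp: linear_on_def tensor_functional_def) (auto simp: fun_scale_def)
qed

lemma tensor_functional_tensor:
  assumes "finite I" and "\<And>i. i \<in> I \<Longrightarrow> linear_on s (*) (F i) (f i)" and x: "x \<in> Pi\<^sub>E I F"
  shows "tensor_functional s I F f (tensor s I F x) = (\<Prod>i\<in>I. f i (x i))"
proof -
  have *: "(\<Prod>j\<in>I. f j ((z(i := y)) j)) = f i y * (\<Prod>j\<in>I - {i}. f j (z j))" if "i \<in> I" for z i y
  proof -
    have "(\<Prod>j\<in>I - {i}. f j ((z(i := y)) j)) = (\<Prod>j\<in>I - {i}. f j (z j))"
      by (rule prod.cong) auto
    then show ?thesis using that \<open>finite I\<close> by (subst prod.remove[of _ i]) auto
  qed
  have "multilinear_on s (*) I F (\<lambda>y. \<Prod>i\<in>I. f i (y i))"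
    using assms(2) by (simp add: multilinear_on_def linear_on_def * algebra_simps
        del: fun_upd_apply)
  then show ?thesis using x
    by (simp add: tensor_functional_def tensor_def[of s I F x] tensor_in_tensor_space[OF x, unfolded tensor_def])
qed

theorem tensor_functional_unique:
  fixes s :: "'k::field \<Rightarrow> 'a::ab_group_add \<Rightarrow> 'a"
  assumes "finite I" and "\<And>i. i \<in> I \<Longrightarrow> linear_on s (*) (F i) (f i)"
  shows "\<phi> = tensor_functional s I F f \<longleftrightarrow>
    linear_on fun_scale (*) (tensor_space s I F) \<phi> \<and> (\<forall>u. u \<notin> tensor_space s I F \<longrightarrow> \<phi> u = 0) \<and>
    (\<forall>x\<in>Pi\<^sub>E I F. \<phi> (tensor s I F x) = (\<Prod>i\<in>I. f i (x i)))" (is "_ \<longleftrightarrow> ?R")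
proof
  assume "\<phi> = tensor_functional s I F f"
  then show ?R
    by (simp add: linear_on_tensor_functional tensor_functional_tensor[OF assms])
      (simp add: tensor_functional_def)
next
  assume R: ?R
  have K: "vector_space ((*) :: 'k \<Rightarrow> 'k \<Rightarrow> 'k)"
    by unfold_locales (auto simp: algebra_simps)
  show "\<phi> = tensor_functional s I F f"
  proof
    fix u
    show "\<phi> u = tensor_functional s I F f u"
    proof (cases "u \<in> tensor_space s I F")
      case True
      show ?thesis
        by (rule linear_on_tensor_space_eqI[OF K _ linear_on_tensor_functional _ True])
          (use R in \<open>simp_all add: tensor_functional_tensor[OF assms]\<close>)
    next
      case False
      then show ?thesis using R by (simp add: tensor_functional_def)
    qed
  qed
qed

end

theory Submission
  imports Defs
begin

text \<open>
  For biorthogonal families \<open>x\<close>, \<open>xs\<close> with \<open>x\<close> spanning, every vector is \<open>\<Sum>\<^sub>i xs i y * x i\<close> and every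
  functional is \<open>\<Sum>\<^sub>i f (x i) * xs i\<close>, so both are bases; and
  \<open>1 = \<bar>xs i (x i)\<bar> \<le> \<parallel>xs i\<parallel> \<parallel>x i\<parallel>\<close> shows that it is enough to bound the norms by \<open>1\<close>. For the
  tensors these bounds are the two defining properties of a reasonable cross norm.
\<close>

section \<open>Linear algebra of biorthogonal families\<close>

text \<open>The kernel of \<open>f i\<close> is a subspace that contains every \<open>x j\<close>
  with \<open>j\<close> different from \<open>i\<close>, hence their span, but it misses
  \<open>x i\<close>. Stated for an arbitrary vector space so that it serves both for vectors and,
  with the roles exchanged, for functionals.\<close>

lemma biorthogonal_independent:
  fixes s :: "'k::field \<Rightarrow> 'a::ab_group_add \<Rightarrow> 'a"
  assumes "vector_space s" and F: "module.subspace s F"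
    and x: "\<And>i. i \<in> I \<Longrightarrow> x i \<in> F"
    and lin: "\<And>i. i \<in> I \<Longrightarrow> linear_on s (*) F (f i)"
    and bi: "\<And>i j. i \<in> I \<Longrightarrow> j \<in> I \<Longrightarrow> f i (x j) = (if i = j then 1 else 0)"
  shows "inj_on x I" and "\<not> module.dependent s (x ` I)"
proof -
  interpret V: vector_space s by fact
  show "inj_on x I"
    using bi by (metis inj_onI zero_neq_one)
  have "x i \<notin> V.span (x ` I - {x i})" if i: "i \<in> I" for i
  proof
    assume "x i \<in> V.span (x ` I - {x i})"
    moreover have "f i 0 = 0"
      using lin[OF i] V.subspace_0[OF F] unfolding linear_on_def
      by (metis V.scale_zero_left mult_zero_left)
    \<comment> \<open>The kernel is taken inside \<open>F\<close>, since \<open>f i\<close> is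
      additive and homogeneous only there.\<close>
    then have "V.subspace {y \<in> F. f i y = 0}"
      using lin[OF i] F unfolding V.subspace_def linear_on_def by simp
    moreover have "x ` I - {x i} \<subseteq> {y \<in> F. f i y = 0}"
      using x bi i by auto
    ultimately have "f i (x i) = 0"
      using V.span_minimal by blast
    then show False using bi[OF i i] by simp
  qed
  then show "\<not> V.dependent (x ` I)"
    by (auto simp: V.dependent_def)
qed

lemma linear_on_sum:
  fixes s :: "'k::field \<Rightarrow> 'a::ab_group_add \<Rightarrow> 'a"
  assumes "vector_space s" "vector_space s'" and F: "module.subspace s F"
    and lin: "linear_on s s' F f" and x: "\<And>i. i \<in> I \<Longrightarrow> x i \<in> F"
  shows "f (\<Sum>i\<in>I. s (c i) (x i)) = (\<Sum>i\<in>I. s' (c i) (f (x i)))"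
proof -
  interpret V: vector_space s by fact
  interpret W: vector_space s' by fact
  \<comment> \<open>Settles the empty index set and also the infinite ones, over which sums are 0 by
    convention.\<close>
  have 0: "f 0 = 0"
    using lin V.subspace_0[OF F] unfolding linear_on_def
    by (metis V.scale_zero_left W.scale_zero_left)
  show ?thesis
    using x
  proof (induction I rule: infinite_finite_induct)
    case (insert i I)
    then have "s (c i) (x i) \<in> F" "(\<Sum>i\<in>I. s (c i) (x i)) \<in> F"
      by (auto intro: V.subspace_scale V.subspace_sum F)
    then show ?case using insert lin by (simp add: linear_on_def)
  qed (simp_all add: 0)
qed

text \<open>Both sides are linear in \<open>y\<close>, so the vectors satisfying the identity form a
  subspace. By biorthogonality it contains each \<open>x j\<close>, hence the whole span.\<close>

lemma biorthogonal_expansion: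
  fixes s :: "'k::field \<Rightarrow> 'a::ab_group_add \<Rightarrow> 'a"
  assumes "vector_space s" and fin: "finite I"
    and span: "module.span s (x ` I) = F"
    and lin: "\<And>i. i \<in> I \<Longrightarrow> linear_on s (*) F (f i)"
    and bi: "\<And>i j. i \<in> I \<Longrightarrow> j \<in> I \<Longrightarrow> f i (x j) = (if i = j then 1 else 0)"
    and y: "y \<in> F"
  shows "y = (\<Sum>i\<in>I. s (f i y) (x i))"
proof -
  interpret V: vector_space s by fact
  have F: "V.subspace F" using span V.subspace_span by blast
  have x: "x i \<in> F" if "i \<in> I" for i using span V.span_base that by blast
  have 0: "f i 0 = 0" if "i \<in> I" for i
    using lin[OF that] V.subspace_0[OF F] unfolding linear_on_def
    by (metis V.scale_zero_left mult_zero_left)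
  have "V.subspace {y \<in> F. y = (\<Sum>i\<in>I. s (f i y) (x i))}"
    unfolding V.subspace_def
  proof (intro conjI ballI allI CollectI)
    fix y z assume "y \<in> {y \<in> F. y = (\<Sum>i\<in>I. s (f i y) (x i))}" "z \<in> {y \<in> F. y = (\<Sum>i\<in>I. s (f i y) (x i))}"
    then have yz: "y \<in> F" "z \<in> F" "(\<Sum>i\<in>I. s (f i y) (x i)) = y" "(\<Sum>i\<in>I. s (f i z) (x i)) = z" by auto
    then show "y + z \<in> F" using F V.subspace_add by blast
    have "(\<Sum>i\<in>I. s (f i (y + z)) (x i)) = (\<Sum>i\<in>I. s (f i y) (x i) + s (f i z) (x i))"
      by (rule sum.cong) (use lin yz in \<open>auto simp: linear_on_def V.scale_left_distrib\<close>)
    then show "y + z = (\<Sum>i\<in>I. s (f i (y + z)) (x i))"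
      using yz by (simp add: sum.distrib)
  next
    fix c y assume "y \<in> {y \<in> F. y = (\<Sum>i\<in>I. s (f i y) (x i))}"
    then have y: "y \<in> F" "(\<Sum>i\<in>I. s (f i y) (x i)) = y" by auto
    then show "s c y \<in> F" using F V.subspace_scale by blast
    have "(\<Sum>i\<in>I. s (f i (s c y)) (x i)) = (\<Sum>i\<in>I. s c (s (f i y) (x i)))"
      by (rule sum.cong) (use lin y in \<open>auto simp: linear_on_def\<close>)
    then show "s c y = (\<Sum>i\<in>I. s (f i (s c y)) (x i))"
      using y(2) V.scale_sum_right[of c "\<lambda>i. s (f i y) (x i)" I] by simp
  qed (use 0 V.subspace_0[OF F] in auto)
  moreover have "x ` I \<subseteq> {y \<in> F. y = (\<Sum>i\<in>I. s (f i y) (x i))}"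
  proof (intro image_subsetI CollectI conjI x)
    fix j assume j: "j \<in> I"
    have "(\<Sum>i\<in>I. s (f i (x j)) (x i)) = (\<Sum>i\<in>I. if i = j then x i else 0)"
      by (rule sum.cong) (use bi j in auto)
    then show "x j = (\<Sum>i\<in>I. s (f i (x j)) (x i))"
      using fin j by simp
  qed
  ultimately show ?thesis
    using V.span_minimal y span by blast
qed

section \<open>Dual spaces and norm estimates\<close>

lemma sum_apply: "(\<Sum>i\<in>I. f i) y = (\<Sum>i\<in>I. f i y :: 'b::comm_monoid_add)"
  by (induction I rule: infinite_finite_induct) auto

text \<open>This keeps the span of a dual family inside the dual space. Bounds add under sums and
  are multiplied by \<open>norm c\<close> under scaling.\<close>

lemma subspace_dual_space:
  fixes s :: "'k::real_normed_field \<Rightarrow> 'a::ab_group_add \<Rightarrow> 'a"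
  shows "module.subspace fun_scale (dual_space s F N)"
proof -
  interpret D: vector_space "fun_scale :: 'k \<Rightarrow> ('a \<Rightarrow> 'k) \<Rightarrow> 'a \<Rightarrow> 'k"
    by (rule vector_space_fun_scale)
  show ?thesis
    unfolding D.subspace_def
  proof (intro conjI ballI allI)
    show "0 \<in> dual_space s F N"
      by (auto simp: dual_space_def linear_on_def intro!: exI[of _ 0])
  next
    fix f g assume "f \<in> dual_space s F N" "g \<in> dual_space s F N"
    then obtain A B where fg: "linear_on s (*) F f" "linear_on s (*) F g"
      "\<And>x. x \<notin> F \<Longrightarrow> f x = 0" "\<And>x. x \<notin> F \<Longrightarrow> g x = 0"
      "\<And>x. x \<in> F \<Longrightarrow> norm (f x) \<le> A * N x" "\<And>x. x \<in> F \<Longrightarrow> norm (g x) \<le> B * N x"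
      unfolding dual_space_def by blast
    have "norm (f x + g x) \<le> (A + B) * N x" if "x \<in> F" for x
      using fg(5,6)[OF that] norm_triangle_ineq[of "f x" "g x"] by (simp add: distrib_right)
    then have "\<exists>C. \<forall>x\<in>F. norm (f x + g x) \<le> C * N x" by blast
    with fg(1-4) show "f + g \<in> dual_space s F N"
      by (simp add: dual_space_def linear_on_def distrib_left)
  next
    fix c f assume "f \<in> dual_space s F N"
    then obtain A where f: "linear_on s (*) F f" "\<And>x. x \<notin> F \<Longrightarrow> f x = 0"
      "\<And>x. x \<in> F \<Longrightarrow> norm (f x) \<le> A * N x"
      unfolding dual_space_def by blast
    have "norm (c * f x) \<le> (norm c * A) * N x" if "x \<in> F" for x
      using mult_left_mono[OF f(3)[OF that], of "norm c"] by (simp add: norm_mult mult.assoc)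
    then have "\<exists>C. \<forall>x\<in>F. norm (c * f x) \<le> C * N x" by blast
    with f(1,2) show "fun_scale c f \<in> dual_space s F N"
      by (simp add: dual_space_def linear_on_def fun_scale_def distrib_left mult.left_commute)
  qed
qed

text \<open>By homogeneity it suffices to scale \<open>x\<close> to norm 1 and compare with the
  supremum. The bound in \<open>dual_space\<close> makes the set of values on the unit ball bounded
  above, so that the supremum really is an upper bound.\<close>

lemma norm_le_dual_norm:
  fixes s :: "'k::real_normed_field \<Rightarrow> 'a::ab_group_add \<Rightarrow> 'a"
  assumes "vector_space s" and F: "module.subspace s F" and N: "norm_on s F N"
    and f: "f \<in> dual_space s F N" and x: "x \<in> F"
  shows "norm (f x) \<le> dual_norm F N f * N x"
proof -
  interpret V: vector_space s by fact
  obtain C where lin: "linear_on s (*) F f" and C: "\<And>x. x \<in> F \<Longrightarrow> norm (f x) \<le> C * N x"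
    using f unfolding dual_space_def by blast
  show ?thesis
  proof (cases "N x = 0")
    case True
    then show ?thesis using C[OF x] by simp
  next
    case False
    then have pos: "0 < N x" using N x unfolding norm_on_def by force
    define y where "y = s (inverse (of_real (N x))) x"
    have y: "y \<in> F" using F x by (simp add: y_def V.subspace_scale)
    have "N y = norm (inverse (of_real (N x)) :: 'k) * N x"
      using N x by (simp add: y_def norm_on_def)
    then have Ny: "N y \<le> 1" using pos by (simp add: norm_inverse)
    \<comment> \<open>The constant \<open>C\<close> is not known to be nonnegative, hence the
      absolute value.\<close>
    have "norm (f z) \<le> \<bar>C\<bar>" if "z \<in> F" "N z \<le> 1" for z
    proof -
      have "0 \<le> N z" using N that by (simp add: norm_on_def)
      then have "C * N z \<le> \<bar>C\<bar> * 1" using that by (intro mult_mono) auto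
      then show ?thesis using C[OF that(1)] by simp
    qed
    then have "bdd_above ((\<lambda>z. norm (f z)) ` {z \<in> F. N z \<le> 1})"
      by (auto intro!: bdd_aboveI)
    then have "norm (f y) \<le> dual_norm F N f"
      unfolding dual_norm_def using y Ny by (intro cSUP_upper) auto
    moreover have "f y = inverse (of_real (N x)) * f x"
      using lin x by (simp add: y_def linear_on_def)
    ultimately have "inverse (N x) * norm (f x) \<le> dual_norm F N f"
      using pos by (simp add: norm_mult norm_inverse)
    then show ?thesis
      using pos by (simp add: field_simps)
  qed
qed

text \<open>Turns convergence of coordinates into convergence in norm in the completeness proof
  below.\<close>

lemma norm_on_sum_le:
  fixes s :: "'k::real_normed_field \<Rightarrow> 'a::ab_group_add \<Rightarrow> 'a"
  assumes "vector_space s" and F: "module.subspace s F" and N: "norm_on s F N"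
    and x: "\<And>i. i \<in> I \<Longrightarrow> x i \<in> F"
  shows "N (\<Sum>i\<in>I. s (c i) (x i)) \<le> (\<Sum>i\<in>I. norm (c i) * N (x i))"
proof -
  interpret V: vector_space s by fact
  have 0: "N 0 = 0" using N V.subspace_0[OF F] by (auto simp: norm_on_def)
  show ?thesis
    using x
  proof (induction I rule: infinite_finite_induct)
    case (insert i I)
    then have "s (c i) (x i) \<in> F" "(\<Sum>i\<in>I. s (c i) (x i)) \<in> F"
      by (auto intro: V.subspace_scale V.subspace_sum F)
    then have "N (s (c i) (x i) + (\<Sum>i\<in>I. s (c i) (x i))) \<le> N (s (c i) (x i)) + N (\<Sum>i\<in>I. s (c i) (x i))"
      using N by (simp add: norm_on_def)
    moreover have "N (s (c i) (x i)) = norm (c i) * N (x i)"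
      using N insert.prems by (simp add: norm_on_def)
    ultimately show ?case using insert by simp
  qed (simp_all add: 0)
qed

section \<open>Completeness and a criterion for Auerbach bases\<close>

text \<open>Bounded coordinate functionals send a Cauchy sequence to Cauchy sequences of scalars,
  which converge because the field is complete; the limits are the coordinates of the limit vector.
  The lemma is there because \<open>reasonable_cross_norm\<close> does not include completeness,
  while \<open>finite_dim_banach\<close> demands it.\<close>

lemma complete_on_if_biorthogonal:
  fixes s :: "'k::{real_normed_field, banach} \<Rightarrow> 'a::ab_group_add \<Rightarrow> 'a"
  assumes "vector_space s" and fin: "finite I"
    and span: "module.span s (x ` I) = F" and N: "norm_on s F N"
    and xs: "\<And>i. i \<in> I \<Longrightarrow> xs i \<in> dual_space s F N"
    and bi: "\<And>i j. i \<in> I \<Longrightarrow> j \<in> I \<Longrightarrow> xs i (x j) = (if i = j then 1 else 0)"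
  shows "complete_on F N"
  unfolding complete_on_def
proof (intro allI impI, elim conjE)
  interpret V: vector_space s by fact
  have F: "V.subspace F" using span V.subspace_span by blast
  have x: "x i \<in> F" if "i \<in> I" for i using span V.span_base that by blast
  have lin: "linear_on s (*) F (xs i)" if "i \<in> I" for i
    using xs[OF that] by (simp add: dual_space_def)
  have diff: "xs i (y - z) = xs i y - xs i z" if "i \<in> I" "y \<in> F" "z \<in> F" for i y z
  proof -
    have "xs i (y - z) + xs i z = xs i y"
      using lin[OF that(1)] that V.subspace_diff[OF F] unfolding linear_on_def
      by (metis diff_add_cancel)
    then show ?thesis by (simp add: algebra_simps)
  qed
  fix u :: "nat \<Rightarrow> 'a"
  assume u: "range u \<subseteq> F" and Cauchy: "\<forall>e>0. \<exists>M. \<forall>p\<ge>M. \<forall>q\<ge>M. N (u p - u q) < e"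
  have uF: "u p \<in> F" for p using u by blast
  have "convergent (\<lambda>p. xs i (u p))" if i: "i \<in> I" for i
  proof -
    obtain C where C: "\<And>y. y \<in> F \<Longrightarrow> norm (xs i y) \<le> C * N y"
      using xs[OF i] unfolding dual_space_def by blast
    have "\<exists>M. \<forall>p\<ge>M. \<forall>q\<ge>M. norm (xs i (u p) - xs i (u q)) < e" if "0 < e" for e
    proof -
      \<comment> \<open>Adding 1 gives a positive denominator whatever \<open>C\<close> is.\<close>
      obtain M where M: "\<And>p q. p \<ge> M \<Longrightarrow> q \<ge> M \<Longrightarrow> N (u p - u q) < e / (\<bar>C\<bar> + 1)"
        using Cauchy \<open>0 < e\<close> by (meson abs_ge_zero add_nonneg_pos divide_pos_pos zero_less_one)
      have "norm (xs i (u p) - xs i (u q)) < e" if "p \<ge> M" "q \<ge> M" for p q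
      proof -
        have mem: "u p - u q \<in> F" using uF F by (simp add: V.subspace_diff)
        then have nonneg: "0 \<le> N (u p - u q)" using N by (simp add: norm_on_def)
        have "norm (xs i (u p) - xs i (u q)) \<le> C * N (u p - u q)"
          using C[OF mem] diff[OF i uF uF] by simp
        also have "\<dots> \<le> (\<bar>C\<bar> + 1) * N (u p - u q)"
          using nonneg by (intro mult_right_mono) auto
        also have "\<dots> < e"
          using M[OF that] by (simp add: field_simps)
        finally show ?thesis .
      qed
      then show ?thesis by blast
    qed
    then show ?thesis
      by (simp add: Cauchy_convergent_iff[symmetric] Cauchy_iff)
  qed
  then obtain c where c: "\<And>i. i \<in> I \<Longrightarrow> (\<lambda>p. xs i (u p)) \<longlonglongrightarrow> c i"
    unfolding convergent_def by metis
  define l where "l = (\<Sum>i\<in>I. s (c i) (x i))"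
  have l: "l \<in> F" unfolding l_def by (intro V.subspace_sum V.subspace_scale F x)
  have bound: "N (u p - l) \<le> (\<Sum>i\<in>I. norm (xs i (u p) - c i) * N (x i))" for p
  proof -
    have "u p = (\<Sum>i\<in>I. s (xs i (u p)) (x i))"
      by (rule biorthogonal_expansion[OF assms(1) fin span lin bi uF])
    then have "u p - l = (\<Sum>i\<in>I. s (xs i (u p) - c i) (x i))"
      unfolding l_def V.scale_left_diff_distrib sum_subtractf by simp
    then show ?thesis using norm_on_sum_le[OF assms(1) F N x] by simp
  qed
  \<comment> \<open>The upper bound of a squeeze: a finite sum of coordinate errors, each tending to
    0.\<close>
  have "(\<lambda>p. \<Sum>i\<in>I. norm (xs i (u p) - c i) * N (x i)) \<longlonglongrightarrow> (\<Sum>i\<in>I. 0 * N (x i))"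
    by (intro tendsto_sum tendsto_mult tendsto_const tendsto_norm_zero LIM_zero c)
  then have "(\<lambda>p. \<Sum>i\<in>I. norm (xs i (u p) - c i) * N (x i)) \<longlonglongrightarrow> 0" by simp
  moreover have "0 \<le> N (u p - l)" for p
    using N V.subspace_diff[OF F uF l] by (simp add: norm_on_def)
  ultimately have "(\<lambda>p. N (u p - l)) \<longlonglongrightarrow> 0"
    using bound by (rule_tac tendsto_sandwich[OF _ _ tendsto_const]) auto
  with l show "\<exists>l\<in>F. (\<lambda>p. N (u p - l)) \<longlonglongrightarrow> 0" by blast
qed

text \<open>Reduces the theorem to conditions that can be checked directly on elementary tensors:
  spanning, biorthogonality and upper bounds for the norms.\<close>

lemma normalized_dual_basis_if_biorthogonal:
  fixes s :: "'k::{real_normed_field, banach} \<Rightarrow> 'a::ab_group_add \<Rightarrow> 'a"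
  assumes "vector_space s" and fin: "finite I"
    and span: "module.span s (x ` I) = F" and N: "norm_on s F N"
    and xs: "\<And>i. i \<in> I \<Longrightarrow> xs i \<in> dual_space s F N"
    and bi: "\<And>i j. i \<in> I \<Longrightarrow> j \<in> I \<Longrightarrow> xs i (x j) = (if i = j then 1 else 0)"
    and Nx: "\<And>i. i \<in> I \<Longrightarrow> N (x i) \<le> 1"
    and Nxs: "\<And>i. i \<in> I \<Longrightarrow> dual_norm F N (xs i) \<le> 1"
  shows "finite_dim_banach s F N" and "auerbach_basis s F N I x"
    and "normalized_dual_basis s F N I x xs"
proof -
  interpret V: vector_space s by fact
  interpret D: vector_space "fun_scale :: 'k \<Rightarrow> ('a \<Rightarrow> 'k) \<Rightarrow> 'a \<Rightarrow> 'k"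
    by (rule vector_space_fun_scale)
  have F: "V.subspace F" using span V.subspace_span by blast
  have x: "x i \<in> F" if "i \<in> I" for i using span V.span_base that by blast
  have lin: "linear_on s (*) F (xs i)" if "i \<in> I" for i
    using xs[OF that] by (simp add: dual_space_def)
  have K: "vector_space ((*) :: 'k \<Rightarrow> 'k \<Rightarrow> 'k)"
    by unfold_locales (auto simp: algebra_simps)
  show "finite_dim_banach s F N"
    unfolding finite_dim_banach_def
    using F N complete_on_if_biorthogonal[OF assms(1-6)] span fin by blast

  have basis: "family_basis s F I x"
    unfolding family_basis_def
    using biorthogonal_independent[OF assms(1) F x lin bi] span by blast

  \<comment> \<open>The roles are exchanged: evaluation at \<open>x i\<close> is a linear functional
    on the space of all functions, and these evaluations are biorthogonal to
    \<open>xs\<close>.\<close>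
  have "inj_on xs I" "D.independent (xs ` I)"
    using biorthogonal_independent[OF D.vector_space_axioms D.subspace_UNIV, of I xs "\<lambda>i f. f (x i)"] bi
    by (auto simp: linear_on_def fun_scale_def)
  moreover have "D.span (xs ` I) = dual_space s F N"
  proof
    show "D.span (xs ` I) \<subseteq> dual_space s F N"
      by (rule D.span_minimal) (use xs subspace_dual_space in auto)
    show "dual_space s F N \<subseteq> D.span (xs ` I)"
    proof
      fix f assume f: "f \<in> dual_space s F N"
      \<comment> \<open>The coefficients come from applying \<open>f\<close> to the expansion of a
        vector of \<open>F\<close>. Outside \<open>F\<close> both sides vanish, since functionals
        are extended by 0.\<close>
      have "f = (\<Sum>i\<in>I. fun_scale (f (x i)) (xs i))"
      proof
        fix y
        show "f y = (\<Sum>i\<in>I. fun_scale (f (x i)) (xs i)) y"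
        proof (cases "y \<in> F")
          case True
          have flin: "linear_on s (*) F f" using f by (simp add: dual_space_def)
          have "f y = f (\<Sum>i\<in>I. s (xs i y) (x i))"
            using biorthogonal_expansion[OF assms(1) fin span lin bi True] by simp
          also have "\<dots> = (\<Sum>i\<in>I. xs i y * f (x i))"
            by (rule linear_on_sum[OF assms(1) K F flin x])
          finally show ?thesis
            by (simp add: sum_apply fun_scale_def mult.commute)
        next
          case False
          then have "f y = 0" "\<And>i. i \<in> I \<Longrightarrow> xs i y = 0"
            using f xs by (auto simp: dual_space_def)
          then show ?thesis by (simp add: sum_apply fun_scale_def)
        qed
      qed
      then show "f \<in> D.span (xs ` I)"
        by (metis (no_types, lifting) D.span_base D.span_scale D.span_sum imageI)
    qed
  qed
  ultimately have dual: "family_basis fun_scale (dual_space s F N) I xs"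
    by (simp add: family_basis_def)

  have norms: "N (x i) = 1 \<and> dual_norm F N (xs i) = 1" if i: "i \<in> I" for i
  proof -
    have N0: "0 \<le> N (x i)" using N x[OF i] by (simp add: norm_on_def)
    have 1: "1 \<le> dual_norm F N (xs i) * N (x i)"
      using norm_le_dual_norm[OF assms(1) F N xs[OF i] x[OF i]] bi[OF i i] by simp
    \<comment> \<open>Bounding the dual norm first forces \<open>N (x i) = 1\<close>; put back into
      fact \<open>1\<close>, this gives the lower bound for the dual norm.\<close>
    also have "\<dots> \<le> 1 * N (x i)"
      using N0 Nxs[OF i] by (intro mult_right_mono) auto
    finally have "N (x i) = 1" using Nx[OF i] by simp
    with 1 Nxs[OF i] show ?thesis by simp
  qed
  show "normalized_dual_basis s F N I x xs"
    unfolding normalized_dual_basis_def using dual bi norms by blast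
  then show "auerbach_basis s F N I x"
    unfolding auerbach_basis_def using basis norms by blast
qed

section \<open>Generators of the tensor product\<close>

text \<open>Elementary tensors span the tensor space by definition, and multilinearity expands each
  of them into tensors of generators.\<close>

lemma span_tensor_basis:
  fixes s :: "'k::field \<Rightarrow> 'a::ab_group_add \<Rightarrow> 'a"
  assumes "vector_space s" and fin: "finite I"
    and span: "\<And>i. i \<in> I \<Longrightarrow> module.span s (x i ` K i) = F i"
  shows "module.span fun_scale ((\<lambda>k. tensor s I F (\<lambda>i. x i (k i))) ` Pi\<^sub>E I K) = tensor_space s I F"
    (is "module.span _ ?T = _")
proof -
  interpret V: vector_space s by fact
  interpret T: vector_space "fun_scale :: 'k \<Rightarrow> ('i, 'a, 'k) tensor \<Rightarrow> ('i, 'a, 'k) tensor"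
    by (rule vector_space_fun_scale)
  have F: "V.subspace (F i)" if "i \<in> I" for i
    using span[OF that] V.subspace_span by metis
  have x: "x i k \<in> F i" if "i \<in> I" "k \<in> K i" for i k
    using span[OF that(1)] V.span_base that(2) by blast
  \<comment> \<open>\<open>tensor\<close> sees its argument only on \<open>I\<close>. So
    \<open>\<lambda>i. x i (k i)\<close>, which may take any values off \<open>I\<close>, can be
    exchanged with its restriction, which lies in \<open>Pi\<^sub>E I F\<close>.\<close>
  have restrict: "tensor s I F (restrict y I) = tensor s I F y" for y
    by (simp only: tensor_def restrict_restrict Int_absorb)
  \<comment> \<open>Expand the coordinates in \<open>J\<close> one at a time, the others being basis vectors already.\<close>
  have "tensor s I F y \<in> T.span ?T"
    if "J \<subseteq> I" "y \<in> Pi\<^sub>E I F" "\<And>i. i \<in> I - J \<Longrightarrow> y i \<in> x i ` K i" for J y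
    using finite_subset[OF \<open>J \<subseteq> I\<close> fin] that
  proof (induction J arbitrary: y rule: finite_induct)
    case empty
    then have "\<forall>i\<in>I. \<exists>k. k \<in> K i \<and> y i = x i k" by blast
    then obtain k where k: "\<And>i. i \<in> I \<Longrightarrow> k i \<in> K i \<and> y i = x i (k i)" by metis
    have "restrict (\<lambda>i. x i (restrict k I i)) I = y"
      using k empty(2) by (auto simp: fun_eq_iff PiE_def extensional_def)
    then have "tensor s I F y = tensor s I F (\<lambda>i. x i (restrict k I i))"
      using restrict by metis
    moreover have "restrict k I \<in> Pi\<^sub>E I K" using k by auto
    ultimately have "tensor s I F y \<in> ?T" by (rule image_eqI)
    then show ?case by (rule T.span_base)
  next
    case (insert j J)
    then have j: "j \<in> I" by blast
    \<comment> \<open>The admissible values of coordinate \<open>j\<close> form a subspace by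
      multilinearity. It contains the generators of \<open>F j\<close>: once coordinate
      \<open>j\<close> is a generator, only those in \<open>J\<close> remain to be expanded and the
      induction hypothesis applies.\<close>
    let ?S = "{v \<in> F j. tensor s I F (y(j := v)) \<in> T.span ?T}"
    have lin: "linear_on s fun_scale (F j) (\<lambda>v. tensor s I F (y(j := v)))"
      using multilinear_on_tensor[of s I F] insert.prems j by (simp add: multilinear_on_def)
    have "tensor s I F (y(j := 0)) = 0"
      using lin V.subspace_0[OF F[OF j]] unfolding linear_on_def
      by (metis V.scale_zero_left T.scale_zero_left)
    then have "V.subspace ?S"
      using lin F[OF j] T.span_zero[of ?T] T.span_add[of _ ?T] T.span_scale[of _ ?T]
      by (simp add: V.subspace_def linear_on_def)
    moreover have "x j ` K j \<subseteq> ?S"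
    proof (intro image_subsetI CollectI conjI)
      fix k assume k: "k \<in> K j"
      show "x j k \<in> F j" using x j k by blast
      with insert.prems j have "y(j := x j k) \<in> Pi\<^sub>E I F" by (auto simp: PiE_def extensional_def)
      then show "tensor s I F (y(j := x j k)) \<in> T.span ?T"
        by (rule insert.IH[rotated]) (use insert.prems k in auto)
    qed
    ultimately have "F j \<subseteq> ?S" using V.span_minimal span[OF j] by blast
    then have "y j \<in> ?S" using insert.prems j by blast
    then show ?case by simp
  qed
  \<comment> \<open>For \<open>J = I\<close> the condition on the coordinates outside
    \<open>J\<close> is vacuous.\<close>
  from this[of I] have "tensor s I F ` Pi\<^sub>E I F \<subseteq> T.span ?T" by auto
  then have "tensor_space s I F \<subseteq> T.span ?T"
    unfolding tensor_space_def by (rule T.span_minimal) (rule T.subspace_span)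
  moreover have "?T \<subseteq> tensor_space s I F"
  proof (rule image_subsetI)
    fix k assume "k \<in> Pi\<^sub>E I K"
    then have "restrict (\<lambda>i. x i (k i)) I \<in> Pi\<^sub>E I F" using x by (auto simp: PiE_iff)
    from tensor_in_tensor_space[OF this, of s]
    show "tensor s I F (\<lambda>i. x i (k i)) \<in> tensor_space s I F" by (simp only: restrict)
  qed
  then have "T.span ?T \<subseteq> tensor_space s I F"
    unfolding tensor_space_def by (rule T.span_minimal) (rule T.subspace_span)
  ultimately show ?thesis by blast
qed

section \<open>Tensors of Auerbach bases under a reasonable cross norm\<close>

theorem lemma2p6:
  fixes s :: "'k::{real_normed_field, banach} \<Rightarrow> 'a::ab_group_add \<Rightarrow> 'a"
    and n :: nat
    and F :: "nat \<Rightarrow> 'a set"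
    and N :: "nat \<Rightarrow> 'a \<Rightarrow> real"
    and d :: "nat \<Rightarrow> nat"
    and x :: "nat \<Rightarrow> nat \<Rightarrow> 'a"
    and xs :: "nat \<Rightarrow> nat \<Rightarrow> 'a \<Rightarrow> 'k"
    and \<alpha> :: "(nat, 'a, 'k) tensor \<Rightarrow> real"
  assumes "vector_space s"
    and "1 \<le> n"
    and "\<And>j. j \<in> {1..n} \<Longrightarrow> finite_dim_banach s (F j) (N j)"
    and "\<And>j. j \<in> {1..n} \<Longrightarrow> auerbach_basis s (F j) (N j) {1..d j} (x j)"
    and "\<And>j. j \<in> {1..n} \<Longrightarrow> normalized_dual_basis s (F j) (N j) {1..d j} (x j) (xs j)"
    and "reasonable_cross_norm s {1..n} F N \<alpha>"
  shows "finite_dim_banach fun_scale (tensor_space s {1..n} F) \<alpha> \<and>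
    auerbach_basis fun_scale (tensor_space s {1..n} F) \<alpha>
      (Pi\<^sub>E {1..n} (\<lambda>j. {1..d j})) (\<lambda>k. tensor s {1..n} F (\<lambda>j. x j (k j))) \<and>
    normalized_dual_basis fun_scale (tensor_space s {1..n} F) \<alpha>
      (Pi\<^sub>E {1..n} (\<lambda>j. {1..d j})) (\<lambda>k. tensor s {1..n} F (\<lambda>j. x j (k j)))
      (\<lambda>k. tensor_functional s {1..n} F (\<lambda>j. xs j (k j)))"
proof -
  interpret V: vector_space s by fact
  define I where "I = {1..n}"
  define P where "P = Pi\<^sub>E I (\<lambda>j. {1..d j})"
  let ?V = "tensor_space s I F"
  let ?t = "\<lambda>k. tensor s I F (\<lambda>j. x j (k j))"
  let ?f = "\<lambda>k. tensor_functional s I F (\<lambda>j. xs j (k j))"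
  have fin: "finite I" by (simp add: I_def)
  have finP: "finite P" unfolding P_def by (intro finite_PiE fin) simp
  note au = assms(4)[folded I_def] and nd = assms(5)[folded I_def]
  have span: "V.span (x j ` {1..d j}) = F j" and Nx: "\<And>i. i \<in> {1..d j} \<Longrightarrow> N j (x j i) = 1"
    if "j \<in> I" for j
    using au[OF that] by (auto simp: auerbach_basis_def family_basis_def)
  have xF: "x j i \<in> F j" if "j \<in> I" "i \<in> {1..d j}" for i j
    using span[OF that(1)] V.span_base that(2) by blast
  interpret D: vector_space "fun_scale :: 'k \<Rightarrow> ('a \<Rightarrow> 'k) \<Rightarrow> 'a \<Rightarrow> 'k"
    by (rule vector_space_fun_scale)
  have dual: "xs j i \<in> dual_space s (F j) (N j)" and dn: "dual_norm (F j) (N j) (xs j i) = 1"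
    and bi: "\<And>l. l \<in> {1..d j} \<Longrightarrow> xs j i (x j l) = (if i = l then 1 else 0)"
    if "j \<in> I" "i \<in> {1..d j}" for i j
    using nd[OF that(1)] that(2) D.span_base[of "xs j i" "xs j ` {1..d j}"]
    by (auto simp: normalized_dual_basis_def family_basis_def)
  have \<alpha>: "norm_on fun_scale ?V \<alpha>"
    "\<And>y. y \<in> Pi\<^sub>E I F \<Longrightarrow> \<alpha> (tensor s I F y) \<le> (\<Prod>i\<in>I. N i (y i))"
    "\<And>f. (\<And>i. i \<in> I \<Longrightarrow> f i \<in> dual_space s (F i) (N i)) \<Longrightarrow>
        tensor_functional s I F f \<in> dual_space fun_scale ?V \<alpha> \<and>
        dual_norm ?V \<alpha> (tensor_functional s I F f) \<le> (\<Prod>i\<in>I. dual_norm (F i) (N i) (f i))"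
    using assms(6)[folded I_def] unfolding reasonable_cross_norm_def by blast+
  have kj: "k j \<in> {1..d j}" if "k \<in> P" "j \<in> I" for k j
    using that unfolding P_def by blast
  \<comment> \<open>Passing to the restriction puts the argument into \<open>Pi\<^sub>E I F\<close>,
    as both the cross norm inequality and \<open>tensor_functional_tensor\<close> require.\<close>
  have restrict: "?t k = tensor s I F (restrict (\<lambda>j. x j (k j)) I)" for k
    by (simp only: tensor_def restrict_restrict Int_absorb)
  have mem: "restrict (\<lambda>j. x j (k j)) I \<in> Pi\<^sub>E I F" if "k \<in> P" for k
    using xF kj[OF that] by auto
  have biorth: "?f k (?t l) = (if k = l then 1 else 0)" if "k \<in> P" "l \<in> P" for k l
  proof -
    have "?f k (?t l) = (\<Prod>j\<in>I. xs j (k j) (restrict (\<lambda>j. x j (l j)) I j))"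
      unfolding restrict
      by (rule tensor_functional_tensor[OF fin _ mem[OF that(2)]])
        (use dual kj[OF that(1)] in \<open>auto simp: dual_space_def\<close>)
    also have "\<dots> = (\<Prod>j\<in>I. if k j = l j then 1 else 0)"
      by (rule prod.cong) (use bi kj that in auto)
    \<comment> \<open>A product of Kronecker deltas vanishes as soon as two coordinates
      differ.\<close>
    also have "\<dots> = (if \<forall>j\<in>I. k j = l j then 1 else 0)"
      using fin by (auto intro: prod.neutral)
    \<comment> \<open>Multi-indices in \<open>P\<close> are extensional, so agreement on
      \<open>I\<close> is equality.\<close>
    also have "(\<forall>j\<in>I. k j = l j) \<longleftrightarrow> k = l"
      using that unfolding P_def by (metis PiE_ext)
    finally show ?thesis .
  qed
  have t1: "\<alpha> (?t k) \<le> 1" if "k \<in> P" for k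
  proof -
    have "\<alpha> (?t k) \<le> (\<Prod>j\<in>I. N j (restrict (\<lambda>j. x j (k j)) I j))"
      unfolding restrict by (rule \<alpha>(2)[OF mem[OF that]])
    also have "\<dots> = 1" by (rule prod.neutral) (use Nx kj[OF that] in auto)
    finally show ?thesis .
  qed
  \<comment> \<open>The second cross norm property applies to the dual basis vectors, whose dual
    norms multiply to 1.\<close>
  have f1: "?f k \<in> dual_space fun_scale ?V \<alpha>" "dual_norm ?V \<alpha> (?f k) \<le> 1" if "k \<in> P" for k
  proof -
    have "(\<Prod>j\<in>I. dual_norm (F j) (N j) (xs j (k j))) = 1"
      by (rule prod.neutral) (use dn kj[OF that] in auto)
    with \<alpha>(3)[of "\<lambda>j. xs j (k j)"] dual kj[OF that]
    show "?f k \<in> dual_space fun_scale ?V \<alpha>" "dual_norm ?V \<alpha> (?f k) \<le> 1" by auto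
  qed
  have "module.span fun_scale (?t ` P) = ?V"
    unfolding P_def by (rule span_tensor_basis[OF assms(1) fin span])
  from normalized_dual_basis_if_biorthogonal[OF vector_space_fun_scale finP this \<alpha>(1) f1(1) biorth t1 f1(2)]
  show ?thesis
    unfolding I_def P_def by blast
qed

end
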